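(* If $\gamma$ is a perfectly nested circuit with $m$ internal vertices, then the partial orders $(X_\gamma,\leq_\gamma)$ and $(S_m,\leq_m)$ are isomorphic.
   Context: All graphs are simple. A circuit is a closed walk $\gamma=v_0v_1\dots v_n$ ($v_0=v_n$) with no repeated edges. If $i<j$ and $v_i=v_j$, then $v_iv_{i+1}\dots v_j$ is a sub-circuit of $\gamma$, denoted $[i,j]$; it is proper if $(i,j)\neq(0,n)$. For a proper sub-circuit $[i,j]$, the internal reduction of $\gamma$ at $i$ is the closed walk $v_0\dots v_iv_{j+1}\dots v_n$ if $i\ne 0$ and $v_j\dots v_n$ if $i=0$; the external reduction of $\gamma$ at $i$ is the closed walk $v_iv_{i+1}\dots v_j$. Write $\gamma\rightarrow_C\delta$ if $\delta$ is an (internal or external) reduction of $\gamma$ at some $i$, and let $\stackrel{*}{\rightarrow}_C$ be the reflexive transitive closure of $\rightarrow_C$. The family of reductions of $\gamma$ is $X_\gamma=\{\delta\subseteq\gamma : \gamma\stackrel{*}{\rightarrow}_C\delta\}$, and for $\xi,\eta\in X_\gamma$, $\xi\leq_\gamma\eta$ iff $\eta\stackrel{*}{\rightarrow}_C\xi$. An intersection of $\gamma=v_0\dots v_n$ is a pair $(i,j)$ with $0<i<j<n$ and $v_i=v_j$. A vertex $v$ is an internal vertex of $\gamma$ if $v=v_i=v_j$ for some intersection $(i,j)$. A circuit $\gamma=v_0v_1\dots v_n$ is a perfectly nested circuit if either it is a simple cycle (vertices appear only once, except that the first and last coincide), or there is a sequence $0=k_0<k_1<\dots<k_m<k'_m<\dots<k'_1<k'_0=n$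 with $m\ge 1$ such that: (1) the set of internal vertices of $\gamma$ is $\{v_{k_1},\dots,v_{k_m}\}$; (2) for $1\le i\le m$, $v_{k_i}$ is the vertex associated to the intersection $(k_i,k'_i)$, i.e. $v_{k_i}=v_{k'_i}$; (3) $v_{k_i}\ne v_{k_j}$ whenever $i\neq j$. $2^{\leq m}$ is the set of all binary sequences of length at most $m$ (including the empty one). For $s,t\in 2^{\le m}$, $s\sim_m t$ iff $s$ and $t$ have the same length and the same number of 1's; this is an equivalence relation, and $S_m=2^{\leq m}/\sim_m$. For $[s],[t]\in S_m$, $[s]\leq_m[t]$ iff there are $s'\in[s]$ and $t'\in[t]$ such that $s'$ extends $t'$ (i.e. $t'$ is an initial segment of $s'$).
   Formalization: "Perfectly nested" is taken to require also that the only coincidences v_i = v_j (i<j) are (0,n) and the pairs (k_l,k'_l); without this the claim fails, e.g. for v a y b c y d e y f g v (m = 1, 7 reductions, but S_1 has 3 elements). *)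

theory Defs
  imports Main "HOL-Library.Sublist"
begin

definition simple_graph :: "'a set \<Rightarrow> 'a set set \<Rightarrow> bool" where
  "simple_graph V E \<longleftrightarrow> (\<forall>e\<in>E. e \<subseteq> V \<and> card e = 2)"

(* A walk v_0 v_1 ... v_n is the list of its n + 1 vertices.  Two closed walks are equal iff these
   sequences are equal; they are not identified up to rotation or reversal. *)
type_synonym 'a walk = "'a list"

definition wlen :: "'a walk \<Rightarrow> nat" where
  "wlen \<gamma> = length \<gamma> - 1"

definition wedges :: "'a walk \<Rightarrow> 'a set list" where
  "wedges \<gamma> = map (\<lambda>i. {\<gamma> ! i, \<gamma> ! Suc i}) [0..<wlen \<gamma>]"

definition is_walk :: "'a set \<Rightarrow> 'a set set \<Rightarrow> 'a walk \<Rightarrow> bool" where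
  "is_walk V E \<gamma> \<longleftrightarrow> \<gamma> \<noteq> [] \<and> set \<gamma> \<subseteq> V \<and> set (wedges \<gamma>) \<subseteq> E"

definition circuit :: "'a set \<Rightarrow> 'a set set \<Rightarrow> 'a walk \<Rightarrow> bool" where
  "circuit V E \<gamma> \<longleftrightarrow> is_walk V E \<gamma> \<and> hd \<gamma> = last \<gamma> \<and> distinct (wedges \<gamma>)"

definition subcircuit :: "'a walk \<Rightarrow> nat \<Rightarrow> nat \<Rightarrow> bool" where
  "subcircuit \<gamma> i j \<longleftrightarrow> i < j \<and> j \<le> wlen \<gamma> \<and> \<gamma> ! i = \<gamma> ! j"

definition proper_subcircuit :: "'a walk \<Rightarrow> nat \<Rightarrow> nat \<Rightarrow> bool" where
  "proper_subcircuit \<gamma> i j \<longleftrightarrow> subcircuit \<gamma> i j \<and> (i, j) \<noteq> (0, wlen \<gamma>)"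

definition internal_reduction :: "'a walk \<Rightarrow> nat \<Rightarrow> nat \<Rightarrow> 'a walk" where
  "internal_reduction \<gamma> i j =
     (if i = 0 then drop j \<gamma> else take (Suc i) \<gamma> @ drop (Suc j) \<gamma>)"

definition external_reduction :: "'a walk \<Rightarrow> nat \<Rightarrow> nat \<Rightarrow> 'a walk" where
  "external_reduction \<gamma> i j = drop i (take (Suc j) \<gamma>)"

definition reduces :: "'a walk \<Rightarrow> 'a walk \<Rightarrow> bool" where
  "reduces \<gamma> \<delta> \<longleftrightarrow> (\<exists>i j. proper_subcircuit \<gamma> i j \<and>
     (\<delta> = internal_reduction \<gamma> i j \<or> \<delta> = external_reduction \<gamma> i j))"

definition subwalk :: "'a walk \<Rightarrow> 'a walk \<Rightarrow> bool" where
  "subwalk \<delta> \<gamma> \<longleftrightarrow> set \<delta> \<subseteq> set \<gamma> \<and> set (wedges \<delta>) \<subseteq> set (wedges \<gamma>)"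

definition reductions :: "'a walk \<Rightarrow> 'a walk set" where
  "reductions \<gamma> = {\<delta>. subwalk \<delta> \<gamma> \<and> reduces\<^sup>*\<^sup>* \<gamma> \<delta>}"

definition reductions_le :: "'a walk \<Rightarrow> 'a walk rel" where
  "reductions_le \<gamma> = {(\<xi>, \<eta>). \<xi> \<in> reductions \<gamma> \<and> \<eta> \<in> reductions \<gamma> \<and> reduces\<^sup>*\<^sup>* \<eta> \<xi>}"

definition intersection :: "'a walk \<Rightarrow> nat \<Rightarrow> nat \<Rightarrow> bool" where
  "intersection \<gamma> i j \<longleftrightarrow> 0 < i \<and> i < j \<and> j < wlen \<gamma> \<and> \<gamma> ! i = \<gamma> ! j"

definition internal_vertices :: "'a walk \<Rightarrow> 'a set" where
  "internal_vertices \<gamma> = {\<gamma> ! i | i j. intersection \<gamma> i j}"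

definition simple_cycle :: "'a set \<Rightarrow> 'a set set \<Rightarrow> 'a walk \<Rightarrow> bool" where
  "simple_cycle V E \<gamma> \<longleftrightarrow> circuit V E \<gamma> \<and> distinct (butlast \<gamma>)"

(* The last conjunct of nested_at says that the pairs (k l, k' l) with l \<le> m are all the
   coincidences of \<gamma>; the pair for l = 0 is (0, n).  In words: (k l, k' l) is the only
   intersection at its vertex, and v_0 is not revisited strictly between 0 and n.  This does not
   follow from the other conjuncts: they also hold, with m = 1, for v a y b c y d e y f g v, where
   y is passed three times, and for x a y b x c y d x, where the base vertex x is revisited, and
   these have 7 and more than 3 reductions. *)
definition nested_at :: "'a walk \<Rightarrow> nat \<Rightarrow> (nat \<Rightarrow> nat) \<Rightarrow> (nat \<Rightarrow> nat) \<Rightarrow> bool" where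
  "nested_at \<gamma> m k k' \<longleftrightarrow>
     k 0 = 0 \<and> k' 0 = wlen \<gamma> \<and>
     (\<forall>l<m. k l < k (Suc l) \<and> k' (Suc l) < k' l) \<and> k m < k' m \<and>
     internal_vertices \<gamma> = {\<gamma> ! k l | l. 1 \<le> l \<and> l \<le> m} \<and>
     (\<forall>l. 1 \<le> l \<and> l \<le> m \<longrightarrow> intersection \<gamma> (k l) (k' l)) \<and>
     (\<forall>i j. 1 \<le> i \<and> i \<le> m \<and> 1 \<le> j \<and> j \<le> m \<and> i \<noteq> j \<longrightarrow> \<gamma> ! k i \<noteq> \<gamma> ! k j) \<and>
     (\<forall>i j. i < j \<and> j \<le> wlen \<gamma> \<and> \<gamma> ! i = \<gamma> ! j \<longrightarrow> (\<exists>l\<le>m. i = k l \<and> j = k' l))"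

definition perfectly_nested_circuit :: "'a set \<Rightarrow> 'a set set \<Rightarrow> 'a walk \<Rightarrow> bool" where
  "perfectly_nested_circuit V E \<gamma> \<longleftrightarrow> circuit V E \<gamma> \<and>
     (simple_cycle V E \<gamma> \<or> (\<exists>m k k'. 1 \<le> m \<and> nested_at \<gamma> m k k'))"

definition binary_upto :: "nat \<Rightarrow> bool list set" where
  "binary_upto m = {s. length s \<le> m}"

definition bin_sim :: "nat \<Rightarrow> bool list rel" where
  "bin_sim m = {(s, t). s \<in> binary_upto m \<and> t \<in> binary_upto m \<and>
     length s = length t \<and> count_list s True = count_list t True}"

definition S_poset :: "nat \<Rightarrow> bool list set set" where
  "S_poset m = binary_upto m // bin_sim m"

definition S_le :: "nat \<Rightarrow> bool list set rel" where
  "S_le m = {(c, d). c \<in> S_poset m \<and> d \<in> S_poset m \<and> (\<exists>s'\<in>c. \<exists>t'\<in>d. prefix t' s')}"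

definition isomorphic_partial_orders :: "'a set \<Rightarrow> 'a rel \<Rightarrow> 'b set \<Rightarrow> 'b rel \<Rightarrow> bool" where
  "isomorphic_partial_orders A r B s \<longleftrightarrow> partial_order_on A r \<and> partial_order_on B s \<and>
     (\<exists>f. bij_betw f A B \<and> (\<forall>x\<in>A. \<forall>y\<in>A. (x, y) \<in> r \<longleftrightarrow> (f x, f y) \<in> s))"

end

theory Submission
  imports Defs
begin

text \<open>The coincidences (k l, k' l) cut \<gamma> into the layers 0, ..., m, where layer l consists of the two
  arcs between the l-th and the (l+1)-st coincidence, and layer m is the innermost cycle.  Reducing
  at the l-th coincidence keeps either the layers below l or the layers from l on, so the reductions
  of \<gamma> are the unions of the layers a, ..., b with a \<le> b \<le> m, ordered by inclusion of intervals.
  A class in S_m is determined by its numbers of 0's and 1's, ordered by the reverse componentwise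
  order; the interval from a to b corresponds to a zeros and m - b ones.\<close>

section \<open>Reductions of walks\<close>

lemma set_wedges: "set (wedges \<gamma>) = {{\<gamma> ! i, \<gamma> ! Suc i} | i. Suc i < length \<gamma>}"
  by (auto simp: wedges_def wlen_def)

lemma subwalk_refl: "subwalk \<gamma> \<gamma>"
  by (simp add: subwalk_def)

lemma subwalk_trans: "subwalk \<xi> \<eta> \<Longrightarrow> subwalk \<eta> \<gamma> \<Longrightarrow> subwalk \<xi> \<gamma>"
  by (auto simp: subwalk_def)

lemma subwalk_take: "subwalk (take n \<gamma>) \<gamma>"
  by (auto simp: subwalk_def set_wedges dest: in_set_takeD)

lemma subwalk_drop: "subwalk (drop n \<gamma>) \<gamma>"
proof -
  have "\<exists>j. {drop n \<gamma> ! i, drop n \<gamma> ! Suc i} = {\<gamma> ! j, \<gamma> ! Suc j} \<and> Suc j < length \<gamma>"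
    if "Suc i < length (drop n \<gamma>)" for i
    using that by (intro exI[of _ "n + i"]) auto
  then show ?thesis
    by (auto simp: subwalk_def set_wedges dest: in_set_dropD)
qed

text \<open>The only newly adjacent pair is at the junction, and it is the old edge from
  \<open>j\<close> to \<open>Suc j\<close>, because positions \<open>i\<close> and \<open>j\<close>
  carry the same vertex.\<close>

lemma subwalk_internal_reduction:
  assumes "subcircuit \<gamma> i j"
  shows "subwalk (internal_reduction \<gamma> i j) \<gamma>"
proof (cases "i = 0")
  case True
  then show ?thesis
    by (simp add: internal_reduction_def subwalk_drop)
next
  case False
  let ?\<delta> = "take (Suc i) \<gamma> @ drop (Suc j) \<gamma>"
  have ij: "i < j" "j < length \<gamma>" "\<gamma> ! i = \<gamma> ! j"
    using assms by (auto simp: subcircuit_def wlen_def)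
  have "\<exists>q. {?\<delta> ! p, ?\<delta> ! Suc p} = {\<gamma> ! q, \<gamma> ! Suc q} \<and> Suc q < length \<gamma>"
    if "Suc p < length ?\<delta>" for p
  proof (cases "p < i")
    case True
    then show ?thesis
      using ij by (intro exI[of _ p]) (auto simp: nth_append)
  next
    case False
    then obtain q where q: "p = i + q"
      using le_Suc_ex by (metis not_le)
    \<comment> \<open>For \<open>q = 0\<close> the retained vertex at \<open>i\<close> is read as
      the one at \<open>j\<close>.\<close>
    have "?\<delta> ! p = \<gamma> ! (j + q)" "?\<delta> ! Suc p = \<gamma> ! Suc (j + q)"
      using ij that by (cases q; simp add: q nth_append)+
    then show ?thesis
      using ij that by (intro exI[of _ "j + q"]) (simp add: q)
  qed
  moreover have "set ?\<delta> \<subseteq> set \<gamma>"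
    by (auto dest: in_set_takeD in_set_dropD)
  ultimately show ?thesis
    using False by (auto simp: internal_reduction_def subwalk_def set_wedges)
qed

lemma reduces_subwalk:
  assumes "reduces \<gamma> \<delta>"
  shows "subwalk \<delta> \<gamma>"
  using assms subwalk_internal_reduction subwalk_trans[OF subwalk_drop subwalk_take]
  by (auto simp: reduces_def proper_subcircuit_def external_reduction_def)

lemma rtranclp_reduces_subwalk: "reduces\<^sup>*\<^sup>* \<gamma> \<delta> \<Longrightarrow> subwalk \<delta> \<gamma>"
  by (induction rule: rtranclp_induct) (auto intro: subwalk_refl subwalk_trans reduces_subwalk)

lemma reductions_eq: "reductions \<gamma> = {\<delta>. reduces\<^sup>*\<^sup>* \<gamma> \<delta>}"
  by (auto simp: reductions_def rtranclp_reduces_subwalk)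

section \<open>Intervals of layers\<close>

definition intervals :: "nat \<Rightarrow> (nat \<times> nat) set" where
  "intervals m = {(a, b). a \<le> b \<and> b \<le> m}"

text \<open>The chain of inequalities expresses inclusion and at the same time puts both pairs into
  \<open>intervals m\<close>.\<close>

definition interval_le :: "nat \<Rightarrow> (nat \<times> nat) rel" where
  "interval_le m = {((a, b), (a', b')). a' \<le> a \<and> a \<le> b \<and> b \<le> b' \<and> b' \<le> m}"

lemma partial_order_interval_le: "partial_order_on (intervals m) (interval_le m)"
  by (auto simp: partial_order_on_def preorder_on_def refl_on_def trans_def antisym_def
      intervals_def interval_le_def)

text \<open>Supplies the order axioms on both sides of the isomorphism: each order is pulled back to
  the elementary order of interval inclusion.\<close>

lemma partial_order_on_transfer:
  assumes P: "partial_order_on P Q" and g: "bij_betw g P A" and sub: "r \<subseteq> A \<times> A"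
    and ord: "\<And>x y. x \<in> P \<Longrightarrow> y \<in> P \<Longrightarrow> (g x, g y) \<in> r \<longleftrightarrow> (x, y) \<in> Q"
  shows "partial_order_on A r"
proof -
  have A: "A = g ` P"
    using g by (simp add: bij_betw_def)
  have "refl_on A r"
    using P ord sub unfolding A by (auto simp: partial_order_on_def preorder_on_def refl_on_def)
  moreover have "trans r"
  proof (rule transI)
    fix u v w assume uv: "(u, v) \<in> r" and vw: "(v, w) \<in> r"
    then obtain x y z where "x \<in> P" "y \<in> P" "z \<in> P" "u = g x" "v = g y" "w = g z"
      using sub unfolding A by blast
    then show "(u, w) \<in> r"
      using P ord uv vw by (auto simp: partial_order_on_def preorder_on_def dest: transD)
  qed
  moreover have "antisym r"
  proof (rule antisymI)
    fix u v assume uv: "(u, v) \<in> r" and vu: "(v, u) \<in> r"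
    then obtain x y where "x \<in> P" "y \<in> P" "u = g x" "v = g y"
      using sub unfolding A by blast
    then show "u = v"
      using P ord uv vu by (auto simp: partial_order_on_def dest: antisymD)
  qed
  ultimately show ?thesis
    using sub by (simp add: partial_order_on_def preorder_on_def)
qed

text \<open>Both orders are compared with a common model; the isomorphism runs from \<open>A\<close>
  back to \<open>P\<close> and on to \<open>B\<close>.\<close>

lemma isomorphic_partial_orders_via:
  assumes P: "partial_order_on P Q"
    and g: "bij_betw g P A" and r: "r \<subseteq> A \<times> A"
    and gr: "\<And>x y. x \<in> P \<Longrightarrow> y \<in> P \<Longrightarrow> (g x, g y) \<in> r \<longleftrightarrow> (x, y) \<in> Q"
    and h: "bij_betw h P B" and s: "s \<subseteq> B \<times> B"
    and hs: "\<And>x y. x \<in> P \<Longrightarrow> y \<in> P \<Longrightarrow> (h x, h y) \<in> s \<longleftrightarrow> (x, y) \<in> Q"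
  shows "isomorphic_partial_orders A r B s"
proof -
  let ?f = "h \<circ> inv_into P g"
  have "bij_betw ?f A B"
    using g h by (blast intro: bij_betw_trans bij_betw_inv_into)
  moreover have "(u, v) \<in> r \<longleftrightarrow> (?f u, ?f v) \<in> s" if "u \<in> A" "v \<in> A" for u v
  proof -
    obtain x y where "x \<in> P" "y \<in> P" "u = g x" "v = g y"
      using \<open>u \<in> A\<close> \<open>v \<in> A\<close> g by (auto simp: bij_betw_def)
    then show ?thesis
      using gr hs g by (simp add: bij_betw_inv_into_left)
  qed
  ultimately show ?thesis
    using partial_order_on_transfer[OF P g r gr] partial_order_on_transfer[OF P h s hs]
    unfolding isomorphic_partial_orders_def by blast
qed

section \<open>Binary sequences\<close>

definition bin_class :: "nat \<Rightarrow> nat \<Rightarrow> bool list set" where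
  "bin_class z p = {s. length s = z + p \<and> count_list s True = p}"

lemma count_list_replicate: "count_list (replicate n x) y = (if x = y then n else 0)"
  by (induction n) auto

lemma replicate_in_bin_class: "replicate p True @ replicate z False \<in> bin_class z p"
  by (simp add: bin_class_def count_list_replicate)

text \<open>The counts can be read off any member, and the canonical sequence shows that there is
  one.\<close>

lemma bin_class_eq_iff: "bin_class z p = bin_class z' p' \<longleftrightarrow> z = z' \<and> p = p'"
proof
  assume "bin_class z p = bin_class z' p'"
  then have "replicate p True @ replicate z False \<in> bin_class z' p'"
    using replicate_in_bin_class by blast
  then show "z = z' \<and> p = p'"
    by (simp add: bin_class_def count_list_replicate)
qed simp

text \<open>Equivalent sequences have equal length, so \<open>z + p \<le> m\<close> keeps the whole
  class within the length bound.\<close>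

lemma bin_sim_class:
  assumes "s \<in> bin_class z p" "z + p \<le> m"
  shows "bin_sim m `` {s} = bin_class z p"
proof -
  have "(s, t) \<in> bin_sim m \<longleftrightarrow> t \<in> bin_class z p" for t
    using assms unfolding bin_sim_def bin_class_def binary_upto_def mem_Collect_eq prod.case by metis
  then show ?thesis by blast
qed

lemma S_poset_eq: "S_poset m = {bin_class z p | z p. z + p \<le> m}"
proof (intro set_eqI iffI)
  fix c assume "c \<in> S_poset m"
  then obtain s where s: "length s \<le> m" "c = bin_sim m `` {s}"
    by (auto simp: S_poset_def quotient_def binary_upto_def)
  let ?p = "count_list s True"
  \<comment> \<open>The count is at most the length, so the truncated subtraction really is the
    number of zeros.\<close>
  have "s \<in> bin_class (length s - ?p) ?p" "length s - ?p + ?p \<le> m"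
    using s count_le_length[of s True] by (auto simp: bin_class_def)
  then show "c \<in> {bin_class z p | z p. z + p \<le> m}"
    using s bin_sim_class by blast
next
  fix c assume "c \<in> {bin_class z p | z p. z + p \<le> m}"
  then obtain z p where zp: "c = bin_class z p" "z + p \<le> m"
    by blast
  then have "c = bin_sim m `` {replicate p True @ replicate z False}"
    using bin_sim_class replicate_in_bin_class by metis
  moreover have "replicate p True @ replicate z False \<in> binary_upto m"
    using zp by (simp add: binary_upto_def)
  ultimately show "c \<in> S_poset m"
    by (auto simp: S_poset_def intro: quotientI)
qed

text \<open>Extending a sequence only adds digits, so neither count decreases; conversely the
  missing ones and zeros can be appended to a canonical member.\<close>

lemma S_le_bin_class:
  assumes "z + p \<le> m" "z' + p' \<le> m"
  shows "(bin_class z p, bin_class z' p') \<in> S_le m \<longleftrightarrow> z' \<le> z \<and> p' \<le> p"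
proof
  assume "(bin_class z p, bin_class z' p') \<in> S_le m"
  then obtain t u where "t \<in> bin_class z' p'" "t @ u \<in> bin_class z p"
    by (auto simp: S_le_def prefix_def)
  \<comment> \<open>The suffix \<open>u\<close> contributes
    \<open>length u - count_list u True\<close> zeros.\<close>
  then show "z' \<le> z \<and> p' \<le> p"
    using count_le_length[of u True] by (auto simp: bin_class_def)
next
  assume le: "z' \<le> z \<and> p' \<le> p"
  let ?t = "replicate p' True @ replicate z' False"
  let ?s = "?t @ replicate (p - p') True @ replicate (z - z') False"
  have "?t \<in> bin_class z' p'" "?s \<in> bin_class z p" "prefix ?t ?s"
    using le by (auto simp: bin_class_def count_list_replicate)
  then show "(bin_class z p, bin_class z' p') \<in> S_le m"
    using assms unfolding S_le_def S_poset_eq by blast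
qed

text \<open>The inverse sends z zeros and p ones to the interval from z to m - p, which is nonempty
  because \<open>z + p \<le> m\<close>.\<close>

lemma bij_betw_intervals_S_poset:
  "bij_betw (\<lambda>(a, b). bin_class a (m - b)) (intervals m) (S_poset m)"
proof -
  have "\<exists>a b. bin_class z p = bin_class a (m - b) \<and> a \<le> b \<and> b \<le> m" if "z + p \<le> m" for z p
    using that by (intro exI[of _ z] exI[of _ "m - p"]) auto
  moreover have "\<exists>z p. bin_class a (m - b) = bin_class z p \<and> z + p \<le> m" if "a \<le> b" "b \<le> m" for a b
    using that by (intro exI[of _ a] exI[of _ "m - b"]) auto
  ultimately show ?thesis
    unfolding bij_betw_def inj_on_def intervals_def S_poset_eq
    by (fastforce simp: bin_class_eq_iff image_iff)
qed

section \<open>The layers of a nested circuit\<close>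

text \<open>Strictness of the innermost pair is only demanded for m > 0, so that the one-vertex walk
  is covered with m = 0.\<close>

locale nested =
  fixes \<gamma> :: "'a walk" and m :: nat and k k' :: "nat \<Rightarrow> nat"
  assumes nonempty: "\<gamma> \<noteq> []"
    and k_0: "k 0 = 0" and k'_0: "k' 0 = wlen \<gamma>"
    and k_Suc: "l < m \<Longrightarrow> k l < k (Suc l)" and k'_Suc: "l < m \<Longrightarrow> k' (Suc l) < k' l"
    and innermost: "0 < m \<Longrightarrow> k m < k' m"
    and vertex_eq: "l \<le> m \<Longrightarrow> \<gamma> ! k l = \<gamma> ! k' l"
    and coincidence: "i < j \<Longrightarrow> j \<le> wlen \<gamma> \<Longrightarrow> \<gamma> ! i = \<gamma> ! j \<Longrightarrow> \<exists>l\<le>m. i = k l \<and> j = k' l"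
begin

section \<open>Order and distinctness of the nested positions\<close>

lemma k_less: "a < b \<Longrightarrow> b \<le> m \<Longrightarrow> k a < k b"
proof (induction b)
  case (Suc b)
  then show ?case
    using k_Suc[of b] by (cases "a = b") auto
qed simp

lemma k'_less: "a < b \<Longrightarrow> b \<le> m \<Longrightarrow> k' b < k' a"
proof (induction b)
  case (Suc b)
  then show ?case
    using k'_Suc[of b] by (cases "a = b") auto
qed simp

lemma k_mono: "a \<le> b \<Longrightarrow> b \<le> m \<Longrightarrow> k a \<le> k b"
  using k_less[of a b] by (cases "a = b") auto

lemma k'_mono: "a \<le> b \<Longrightarrow> b \<le> m \<Longrightarrow> k' b \<le> k' a"
  using k'_less[of a b] by (cases "a = b") auto

lemma innermost_le: "k m \<le> k' m"
  using innermost k_0 by (cases m) auto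

lemma k_less_k': "0 < l \<Longrightarrow> l \<le> m \<Longrightarrow> k l < k' l"
  using k_mono[of l m] k'_mono[of l m] innermost by fastforce

lemma k_le_k': "l \<le> m \<Longrightarrow> k l \<le> k' l"
  using k_mono[of l m] k'_mono[of l m] innermost_le by fastforce

lemma k_inj: "a \<le> m \<Longrightarrow> b \<le> m \<Longrightarrow> k a = k b \<longleftrightarrow> a = b"
  using k_less[of a b] k_less[of b a] by (cases a b rule: linorder_cases) auto

text \<open>Equal vertices would make \<open>(k a, k b)\<close> a coincidence, hence the one with
  index \<open>a\<close>; but \<open>k b \<le> k' b < k' a\<close>.\<close>

lemma vertex_inj:
  assumes "a < b" "b \<le> m"
  shows "\<gamma> ! k a \<noteq> \<gamma> ! k b"
proof
  assume eq: "\<gamma> ! k a = \<gamma> ! k b"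
  have less: "k b \<le> k' b" "k' b < k' a" "k' a \<le> wlen \<gamma>"
    using assms k_le_k' k'_less k'_mono[of 0 a] k'_0 by auto
  with coincidence[OF k_less[OF assms] _ eq] obtain l where "l \<le> m" "k a = k l" "k b = k' l"
    by auto
  then show False
    using assms less k_inj[of a l] by auto
qed

text \<open>The walk through the layers a, ..., b jumps from position turn b to position turn' b, which
  carry the same vertex.  For b = m nothing is skipped.\<close>

definition turn :: "nat \<Rightarrow> nat" where
  "turn b = (if b < m then k (Suc b) else k m)"

definition turn' :: "nat \<Rightarrow> nat" where
  "turn' b = (if b < m then k' (Suc b) else k m)"

text \<open>Translates positions of the layer walk into positions of \<gamma>. The junction vertex
  is listed once, as \<open>turn b\<close>; the value \<open>turn' b\<close> is taken only if it
  equals \<open>turn b\<close>.\<close>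

definition pos :: "nat \<Rightarrow> nat \<Rightarrow> nat \<Rightarrow> nat" where
  "pos a b p = (if k a + p \<le> turn b then k a + p else turn' b - turn b + (k a + p))"

text \<open>The number of edges before the jump plus the number after it.\<close>

definition len :: "nat \<Rightarrow> nat \<Rightarrow> nat" where
  "len a b = (turn b - k a) + (k' a - turn' b)"

definition layers :: "nat \<Rightarrow> nat \<Rightarrow> 'a walk" where
  "layers a b = map (\<lambda>p. \<gamma> ! pos a b p) [0..<Suc (len a b)]"

lemma length_layers [simp]: "length (layers a b) = Suc (len a b)"
  by (simp add: layers_def)

lemma wlen_layers [simp]: "wlen (layers a b) = len a b"
  by (simp add: wlen_def)

lemma nth_layers [simp]: "p \<le> len a b \<Longrightarrow> layers a b ! p = \<gamma> ! pos a b p"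
  by (simp add: layers_def del: upt_Suc)

lemma turn_bounds:
  assumes "b \<le> m"
  shows "k b \<le> turn b" "turn b \<le> turn' b" "turn' b \<le> k' b"
proof -
  have "k b \<le> turn b \<and> turn b \<le> turn' b \<and> turn' b \<le> k' b"
  proof (cases "b < m")
    case True
    then show ?thesis
      using k_Suc[of b] k'_Suc[of b] k_le_k'[of "Suc b"] by (simp add: turn_def turn'_def)
  next
    case False
    then show ?thesis
      using assms innermost_le by (simp add: turn_def turn'_def)
  qed
  then show "k b \<le> turn b" "turn b \<le> turn' b" "turn' b \<le> k' b"
    by simp_all
qed

lemma bounds:
  assumes "a \<le> b" "b \<le> m"
  shows "k a \<le> turn b" "turn b \<le> turn' b" "turn' b \<le> k' a"
  using turn_bounds[of b] assms k_mono[of a b] k'_mono[of a b] by auto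

text \<open>For \<open>b = m\<close> both turning positions are \<open>k m\<close>, so
  \<open>pos 0 m\<close> is the identity.\<close>

lemma layers_0_m: "layers 0 m = \<gamma>"
proof (rule nth_equalityI)
  show len: "length (layers 0 m) = length \<gamma>"
  proof -
    have "length \<gamma> = Suc (wlen \<gamma>)"
      using nonempty by (simp add: wlen_def)
    then show ?thesis
      using bounds[of 0 m] by (simp add: len_def turn_def turn'_def k_0 k'_0)
  qed
  show "layers 0 m ! p = \<gamma> ! p" if "p < length (layers 0 m)" for p
    using that by (simp add: pos_def turn_def turn'_def k_0)
qed

text \<open>The coincidences of the walk through the layers a, ..., b, in its own positions.\<close>

definition fst_pos :: "nat \<Rightarrow> nat \<Rightarrow> nat" where
  "fst_pos a l = k l - k a"

definition snd_pos :: "nat \<Rightarrow> nat \<Rightarrow> nat \<Rightarrow> nat" where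
  "snd_pos a b l = (turn b - k a) + (k' l - turn' b)"

text \<open>Coincidence \<open>l\<close> survives because both of its positions lie outside the
  skipped stretch; it is proper because \<open>a < l\<close> puts its first position after the
  start.\<close>

lemma layers_subcircuit:
  assumes "a < l" "l \<le> b" "b \<le> m"
  shows "proper_subcircuit (layers a b) (fst_pos a l) (snd_pos a b l)"
proof -
  have less: "k a < k l" "k l < k' l" "k' l < k' a"
    using assms k_less k'_less k_less_k' by auto
  have ineq: "k l \<le> turn b" "turn b \<le> turn' b" "turn' b \<le> k' l"
    using bounds[of l b] assms by auto
  \<comment> \<open>If \<open>b < m\<close>, strictness comes from \<open>k l < turn b\<close>; if
    \<open>b = m\<close>, it is \<open>k l < k' l\<close>.\<close>
  have "fst_pos a l < snd_pos a b l"
  proof (cases "b < m")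
    case True
    then have "k l < turn b"
      using assms k_less[of l "Suc b"] by (auto simp: turn_def)
    then show ?thesis
      using less ineq by (auto simp: fst_pos_def snd_pos_def)
  next
    case False
    then have "turn b = turn' b"
      by (simp add: turn_def turn'_def)
    then show ?thesis
      using less ineq by (auto simp: fst_pos_def snd_pos_def)
  qed
  moreover have sl: "snd_pos a b l \<le> len a b"
    using less ineq by (auto simp: snd_pos_def len_def)
  moreover have "pos a b (fst_pos a l) = k l"
    using less ineq by (auto simp: pos_def fst_pos_def)
  moreover have "\<gamma> ! pos a b (snd_pos a b l) = \<gamma> ! k' l"
  \<comment> \<open>The first case is contradictory: \<open>k' l\<close> lies strictly beyond
    \<open>turn' b\<close>, the position that \<open>pos\<close> may miss.\<close>
  proof (cases "k' l = turn' b")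
    case True
    have "b < m \<Longrightarrow> k' (Suc b) < k' l"
      using assms k'_less by simp
    moreover have "\<not> b < m \<Longrightarrow> k m < k' l"
      using assms innermost k'_mono[of l m] by simp
    ultimately show ?thesis
      using True by (auto simp: turn'_def split: if_splits)
  next
    case False
    then have "pos a b (snd_pos a b l) = k' l"
      using less ineq by (auto simp: pos_def snd_pos_def)
    then show ?thesis by simp
  qed
  ultimately show ?thesis
    using less vertex_eq[of l] assms
    by (auto simp: proper_subcircuit_def subcircuit_def fst_pos_def)
qed

text \<open>Since \<open>pos\<close> is strictly increasing, a coincidence of the layer walk is one
  of \<gamma>, hence some \<open>(k l, k' l)\<close>; it remains to place \<open>l\<close> in the
  interval.\<close>

lemma layers_subcircuitD:
  assumes ab: "a \<le> b" "b \<le> m" and "proper_subcircuit (layers a b) i j"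
  shows "\<exists>l. a < l \<and> l \<le> b \<and> i = fst_pos a l \<and> j = snd_pos a b l"
proof -
  have ij: "i < j" "j \<le> len a b" "\<gamma> ! pos a b i = \<gamma> ! pos a b j" "(i, j) \<noteq> (0, len a b)"
    using assms(3) by (auto simp: proper_subcircuit_def subcircuit_def)
  note bd = bounds[OF ab]
  have "pos a b i < pos a b j" "pos a b j \<le> k' a"
    using ij bd by (auto simp: pos_def len_def)
  moreover have "k' a \<le> wlen \<gamma>"
    using k'_mono[of 0 a] ab k'_0 by simp
  ultimately obtain l where l: "l \<le> m" "pos a b i = k l" "pos a b j = k' l"
    using coincidence[of "pos a b i" "pos a b j"] ij by auto
  have "k a \<le> k l"
    using l bd by (auto simp: pos_def split: if_splits)
  then have al: "a \<le> l"
    using k_less[of l a] ab by (cases "l < a") auto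
  \<comment> \<open>For \<open>l > b\<close> both positions would lie between \<open>turn b\<close>
    and \<open>turn' b\<close>, where \<open>pos\<close> takes only the value \<open>turn b\<close>;
    but \<open>k l < k' l\<close>.\<close>
  have lb: "l \<le> b"
  proof (rule ccontr)
    assume "\<not> l \<le> b"
    then have l': "b < m" "Suc b \<le> l"
      using l by auto
    then have t: "turn b \<le> k l" "k' l \<le> turn' b" "turn b < turn' b"
      using l k_mono[of "Suc b" l] k'_mono[of "Suc b" l] k_less_k'[of "Suc b"]
      by (auto simp: turn_def turn'_def)
    have "k' l \<le> turn b"
      using l t by (auto simp: pos_def split: if_splits)
    then show False
      using t k_less_k'[of l] l l' by auto
  qed
  have bl: "k l \<le> turn b" "turn' b \<le> k' l"
    using bounds[of l b] lb ab by auto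
  have i: "i = fst_pos a l"
    using l bl bd by (auto simp: fst_pos_def pos_def split: if_splits)
  have j: "j = snd_pos a b l"
    using l bl bd by (auto simp: snd_pos_def pos_def split: if_splits)
  \<comment> \<open>Index \<open>a\<close> belongs to the pair of ends, which properness
    excludes.\<close>
  have "a \<noteq> l"
  proof
    assume "a = l"
    then show False
      using i j ij by (auto simp: fst_pos_def snd_pos_def len_def)
  qed
  then show ?thesis
    using al lb i j by (intro exI[of _ l]) simp
qed

text \<open>The cut-out part keeps the jump of the whole walk, so positions are merely shifted by
  \<open>fst_pos a l\<close>.\<close>

lemma external_reduction_layers:
  assumes "a < l" "l \<le> b" "b \<le> m"
  shows "external_reduction (layers a b) (fst_pos a l) (snd_pos a b l) = layers l b"
proof -
  have less: "k a < k l" "k l < k' l" "k' l < k' a"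
    using assms k_less k'_less k_less_k' by auto
  have ineq: "k l \<le> turn b" "turn b \<le> turn' b" "turn' b \<le> k' l"
    using bounds[of l b] assms by auto
  have sl: "snd_pos a b l \<le> len a b" "snd_pos a b l = fst_pos a l + len l b"
    using less ineq by (auto simp: snd_pos_def fst_pos_def len_def)
  show ?thesis
  proof (rule nth_equalityI)
    show "length (external_reduction (layers a b) (fst_pos a l) (snd_pos a b l)) = length (layers l b)"
      using sl by (simp add: external_reduction_def)
    fix p assume "p < length (external_reduction (layers a b) (fst_pos a l) (snd_pos a b l))"
    then have "p \<le> len l b"
      using sl by (simp add: external_reduction_def)
    then show "external_reduction (layers a b) (fst_pos a l) (snd_pos a b l) ! p = layers l b ! p"
      using sl less by (simp add: external_reduction_def pos_def fst_pos_def)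
  qed
qed

text \<open>Removing the layers from \<open>l\<close> on makes the walk jump from \<open>k l\<close>
  to \<open>k' l\<close>, which is the turning pair of layer \<open>l - 1\<close>.\<close>

lemma internal_reduction_layers:
  assumes "a < l" "l \<le> b" "b \<le> m"
  shows "internal_reduction (layers a b) (fst_pos a l) (snd_pos a b l) = layers a (l - 1)"
proof -
  let ?i = "fst_pos a l" and ?j = "snd_pos a b l"
  have less: "k a < k l" "k l < k' l" "k' l < k' a"
    using assms k_less k'_less k_less_k' by auto
  have ineq: "k l \<le> turn b" "turn b \<le> turn' b" "turn' b \<le> k' l"
    using bounds[of l b] assms by auto
  have turn: "turn (l - Suc 0) = k l" "turn' (l - Suc 0) = k' l"
    using assms by (auto simp: turn_def turn'_def)
  have sl: "?j \<le> len a b" "len a b = ?j + (k' a - k' l)" "?i \<le> ?j"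
    "len a (l - 1) = ?i + (k' a - k' l)"
    using less ineq by (auto simp: snd_pos_def fst_pos_def len_def turn)
  \<comment> \<open>As \<open>k a < k l\<close>, the first position is positive and the branch for
    \<open>i = 0\<close> does not arise.\<close>
  have red: "internal_reduction (layers a b) ?i ?j =
      take (Suc ?i) (layers a b) @ drop (Suc ?j) (layers a b)"
    using less by (simp add: internal_reduction_def fst_pos_def)
  show ?thesis
    unfolding red
  proof (rule nth_equalityI)
    show "length (take (Suc ?i) (layers a b) @ drop (Suc ?j) (layers a b)) = length (layers a (l - 1))"
      using sl by simp
    fix p assume "p < length (take (Suc ?i) (layers a b) @ drop (Suc ?j) (layers a b))"
    then have p: "p \<le> len a (l - 1)"
      using sl by simp
    show "(take (Suc ?i) (layers a b) @ drop (Suc ?j) (layers a b)) ! p = layers a (l - 1) ! p"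
    proof (cases "p \<le> ?i")
      case True
      then have "pos a b p = pos a (l - 1) p"
        using less ineq by (auto simp: pos_def turn fst_pos_def)
      then show ?thesis
        using True p sl by (simp add: nth_append)
    next
      case False
      then obtain q where q: "p = Suc ?i + q"
        using less_iff_Suc_add[of ?i p] by auto
      \<comment> \<open>The vertex at \<open>?j\<close> is dropped in favour of the equal one at
        \<open>?i\<close>, so the tail resumes at \<open>Suc ?j\<close>.\<close>
      have "pos a b (Suc ?j + q) = pos a (l - 1) p"
        using less ineq by (simp add: q pos_def turn fst_pos_def snd_pos_def)
      then show ?thesis
        using p q sl by (simp add: nth_append)
    qed
  qed
qed

section \<open>Intervals reachable by reduction\<close>

lemma reduces_layers:
  assumes "a \<le> b" "b \<le> m"
  shows "reduces (layers a b) \<delta> \<longleftrightarrow>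
    (\<exists>l. a < l \<and> l \<le> b \<and> (\<delta> = layers a (l - 1) \<or> \<delta> = layers l b))"
    (is "?L \<longleftrightarrow> ?R")
proof
  assume ?L
  then obtain i j where ij: "proper_subcircuit (layers a b) i j"
    "\<delta> = internal_reduction (layers a b) i j \<or> \<delta> = external_reduction (layers a b) i j"
    by (auto simp: reduces_def)
  with layers_subcircuitD[OF assms ij(1)] show ?R
    using internal_reduction_layers external_reduction_layers assms by metis
next
  assume ?R
  then show ?L
    using layers_subcircuit internal_reduction_layers external_reduction_layers assms
    unfolding reduces_def by metis
qed

text \<open>Each step shrinks the interval at one end. Conversely two steps suffice: an external
  reduction raises the lower end, then an internal one lowers the upper end.\<close>

lemma rtranclp_reduces_layers:
  assumes ab: "a \<le> b" "b \<le> m"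
  shows "reduces\<^sup>*\<^sup>* (layers a b) \<delta> \<longleftrightarrow> (\<exists>c d. a \<le> c \<and> c \<le> d \<and> d \<le> b \<and> \<delta> = layers c d)"
    (is "?L \<longleftrightarrow> ?R")
proof
  assume ?L
  then show ?R
  proof (induction rule: rtranclp_induct)
    case base
    then show ?case using ab by blast
  next
    case (step y z)
    then obtain c d where cd: "a \<le> c" "c \<le> d" "d \<le> b" "y = layers c d"
      by blast
    then obtain l where l: "c < l" "l \<le> d" "z = layers c (l - 1) \<or> z = layers l d"
      using step reduces_layers[of c d z] ab by auto
    from l(3) show ?case
    proof
      assume "z = layers c (l - 1)"
      then show ?case using cd l by (intro exI[of _ c] exI[of _ "l - 1"]) auto
    next
      assume "z = layers l d"
      then show ?case using cd l by (intro exI[of _ l] exI[of _ d]) auto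
    qed
  qed
next
  assume ?R
  then obtain c d where cd: "a \<le> c" "c \<le> d" "d \<le> b" "\<delta> = layers c d"
    by blast
  have "reduces\<^sup>*\<^sup>* (layers a b) (layers c b)"
  proof (cases "a = c")
    case False
    then show ?thesis
      using cd ab by (intro r_into_rtranclp) (auto simp: reduces_layers intro!: exI[of _ c])
  qed simp
  moreover have "reduces\<^sup>*\<^sup>* (layers c b) (layers c d)"
  proof (cases "d = b")
    case False
    \<comment> \<open>The internal reduction at \<open>l\<close> keeps layers up to
      \<open>l - 1\<close>, hence the witness \<open>Suc d\<close>.\<close>
    then show ?thesis
      using cd ab by (intro r_into_rtranclp) (auto simp: reduces_layers intro!: exI[of _ "Suc d"])
  qed simp
  ultimately show ?L
    using cd by simp
qed

section \<open>Distinct intervals give distinct walks\<close>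

lemma len_strict_mono:
  assumes "a \<le> b" "b < d" "d \<le> m"
  shows "len a b < len a d"
proof -
  note bb = bounds[of a b] and bd = bounds[of a d]
  have t: "turn b = k (Suc b)" "turn' b = k' (Suc b)"
    using assms by (auto simp: turn_def turn'_def)
  have le: "turn b \<le> turn d" "turn' d \<le> turn' b"
    using bounds[of "Suc b" d] assms by (auto simp: t)
  \<comment> \<open>If \<open>d = m\<close>, the innermost cycle is gained; it has positive length
    and is counted on the return side. Otherwise the outward part grows.\<close>
  have "turn b < turn d \<or> turn' d < turn' b"
  proof (cases "d = m")
    case True
    then have "turn' d < turn' b"
      using assms innermost k'_mono[of "Suc b" m] by (auto simp: t) (simp add: turn'_def)
    then show ?thesis ..
  next
    case False
    then show ?thesis
      using assms k_less[of "Suc b" "Suc d"] by (auto simp: t turn_def)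
  qed
  then show ?thesis
    using le bb bd assms by (auto simp: len_def)
qed

text \<open>The starting vertex determines the lower end, and then the length determines the upper
  end.\<close>

lemma layers_inj:
  assumes ab: "a \<le> b" "b \<le> m" and cd: "c \<le> d" "d \<le> m" and eq: "layers a b = layers c d"
  shows "a = c \<and> b = d"
proof -
  have "layers a b ! 0 = layers c d ! 0"
    using eq by simp
  then have "\<gamma> ! k a = \<gamma> ! k c"
    using bounds[OF ab] bounds[OF cd] by (simp add: pos_def)
  then have "a = c"
    using vertex_inj[of a c] vertex_inj[of c a] ab cd by (cases a c rule: linorder_cases) auto
  moreover have "len a b = len c d"
    using eq length_layers by (metis nat.inject)
  ultimately show ?thesis
    using len_strict_mono[of a b d] len_strict_mono[of a d b] ab cd
    by (cases b d rule: linorder_cases) auto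
qed

lemma bij_betw_intervals_reductions:
  "bij_betw (\<lambda>(a, b). layers a b) (intervals m) (reductions \<gamma>)"
proof -
  have "reductions \<gamma> = {layers c d | c d. c \<le> d \<and> d \<le> m}"
    using rtranclp_reduces_layers[of 0 m] by (auto simp: reductions_eq layers_0_m)
  then show ?thesis
    using layers_inj unfolding bij_betw_def inj_on_def intervals_def by auto
qed

lemma reductions_le_layers:
  assumes "a \<le> b" "b \<le> m" "c \<le> d" "d \<le> m"
  shows "(layers a b, layers c d) \<in> reductions_le \<gamma> \<longleftrightarrow> c \<le> a \<and> b \<le> d"
proof -
  have red: "layers a b \<in> reductions \<gamma>" "layers c d \<in> reductions \<gamma>"
    using assms bij_betw_intervals_reductions by (auto simp: bij_betw_def intervals_def)
  then have "(layers a b, layers c d) \<in> reductions_le \<gamma> \<longleftrightarrow>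
      (\<exists>a' b'. c \<le> a' \<and> a' \<le> b' \<and> b' \<le> d \<and> layers a b = layers a' b')"
    using rtranclp_reduces_layers assms by (simp add: reductions_le_def)
  \<comment> \<open>Injectivity identifies \<open>(a', b')\<close> with
    \<open>(a, b)\<close>.\<close>
  also have "\<dots> \<longleftrightarrow> c \<le> a \<and> b \<le> d"
    using layers_inj[of a b] assms le_trans by blast
  finally show ?thesis .
qed

lemma isomorphic: "isomorphic_partial_orders (reductions \<gamma>) (reductions_le \<gamma>) (S_poset m) (S_le m)"
proof (rule isomorphic_partial_orders_via[OF partial_order_interval_le
      bij_betw_intervals_reductions _ _ bij_betw_intervals_S_poset])
  show "reductions_le \<gamma> \<subseteq> reductions \<gamma> \<times> reductions \<gamma>"
    by (auto simp: reductions_le_def)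
  show "S_le m \<subseteq> S_poset m \<times> S_poset m"
    by (auto simp: S_le_def)
next
  fix x y assume "x \<in> intervals m" "y \<in> intervals m"
  then show "(case x of (a, b) \<Rightarrow> layers a b, case y of (a, b) \<Rightarrow> layers a b) \<in> reductions_le \<gamma>
      \<longleftrightarrow> (x, y) \<in> interval_le m"
    by (auto simp: reductions_le_layers intervals_def interval_le_def)
next
  fix x y assume "x \<in> intervals m" "y \<in> intervals m"
  then show "(case x of (a, b) \<Rightarrow> bin_class a (m - b), case y of (a, b) \<Rightarrow> bin_class a (m - b)) \<in> S_le m
      \<longleftrightarrow> (x, y) \<in> interval_le m"
    by (auto simp: S_le_bin_class intervals_def interval_le_def)
qed

end

section \<open>Perfectly nested circuits as instances of the layer structure\<close>

lemma circuit_ends: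
  assumes "circuit V E \<gamma>"
  shows "\<gamma> \<noteq> []" "\<gamma> ! 0 = \<gamma> ! wlen \<gamma>"
proof -
  show ne: "\<gamma> \<noteq> []"
    using assms by (simp add: circuit_def is_walk_def)
  show "\<gamma> ! 0 = \<gamma> ! wlen \<gamma>"
    using assms ne by (simp add: circuit_def wlen_def hd_conv_nth last_conv_nth)
qed

text \<open>Positions before the last carry distinct vertices, so \<open>j\<close> is the last one;
  its vertex is also that of position 0, which forces \<open>i = 0\<close>.\<close>

lemma simple_cycle_coincidence:
  assumes "simple_cycle V E \<gamma>" "i < j" "j \<le> wlen \<gamma>" "\<gamma> ! i = \<gamma> ! j"
  shows "i = 0 \<and> j = wlen \<gamma>"
proof -
  have inj: "p = q" if "p < wlen \<gamma>" "q < wlen \<gamma>" "\<gamma> ! p = \<gamma> ! q" for p q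
    using assms(1) that nth_eq_iff_index_eq[of "butlast \<gamma>" p q]
    by (simp add: simple_cycle_def wlen_def nth_butlast)
  have "\<gamma> ! 0 = \<gamma> ! wlen \<gamma>"
    using assms(1) circuit_ends by (auto simp: simple_cycle_def)
  then show ?thesis
    using inj[of i j] inj[of i 0] assms(2-4) by (cases "j = wlen \<gamma>") auto
qed

text \<open>A simple cycle is a single layer; the constant functions supply the pair of ends, the
  only possible coincidence.\<close>

lemma nested_simple_cycle:
  assumes "simple_cycle V E \<gamma>"
  shows "nested \<gamma> 0 (\<lambda>_. 0) (\<lambda>_. wlen \<gamma>)"
  using assms circuit_ends[of V E \<gamma>] simple_cycle_coincidence[OF assms]
  by unfold_locales (auto simp: simple_cycle_def)

lemma nested_nested_at:
  assumes "circuit V E \<gamma>" and at: "nested_at \<gamma> m k k'"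
  shows "nested \<gamma> m k k'"
proof
  \<comment> \<open>The pair for \<open>l = 0\<close> is not an intersection; its vertices agree
    because the walk is closed.\<close>
  show "\<gamma> ! k l = \<gamma> ! k' l" if "l \<le> m" for l
    using that at circuit_ends(2)[OF assms(1)]
    by (cases "l = 0") (auto simp: nested_at_def intersection_def)
qed (use at circuit_ends(1)[OF assms(1)] in \<open>auto simp: nested_at_def\<close>)

lemma card_internal_vertices_simple_cycle:
  assumes "simple_cycle V E \<gamma>"
  shows "card (internal_vertices \<gamma>) = 0"
proof -
  have "internal_vertices \<gamma> = {}"
    using simple_cycle_coincidence[OF assms]
    by (fastforce simp: internal_vertices_def intersection_def)
  then show ?thesis by simp
qed

text \<open>The positions \<open>k 1\<close>, ..., \<open>k m\<close> enumerate the internal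
  vertices without repetition. This ties the number of layers to the cardinality in the
  theorem.\<close>

lemma card_internal_vertices_nested_at:
  assumes "nested_at \<gamma> m k k'"
  shows "card (internal_vertices \<gamma>) = m"
proof -
  have "internal_vertices \<gamma> = (\<lambda>l. \<gamma> ! k l) ` {1..m}"
    using assms by (auto simp: nested_at_def)
  moreover have "inj_on (\<lambda>l. \<gamma> ! k l) {1..m}"
  proof (rule inj_onI, rule ccontr)
    have "\<forall>i j. 1 \<le> i \<and> i \<le> m \<and> 1 \<le> j \<and> j \<le> m \<and> i \<noteq> j \<longrightarrow> \<gamma> ! k i \<noteq> \<gamma> ! k j"
      using assms by (simp add: nested_at_def)
    then show False
      if "i \<in> {1..m}" "j \<in> {1..m}" "\<gamma> ! k i = \<gamma> ! k j" "i \<noteq> j" for i j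
      using that by simp
  qed
  ultimately show ?thesis
    by (simp add: card_image)
qed

theorem theorem7:
  fixes V :: "'a set" and E :: "'a set set" and \<gamma> :: "'a walk" and m :: nat
  assumes "simple_graph V E"
    and "perfectly_nested_circuit V E \<gamma>"
    and "card (internal_vertices \<gamma>) = m"
  shows "isomorphic_partial_orders (reductions \<gamma>) (reductions_le \<gamma>) (S_poset m) (S_le m)"
proof -
  have circ: "circuit V E \<gamma>"
    using assms by (simp add: perfectly_nested_circuit_def)
  consider (simple) "simple_cycle V E \<gamma>" | (nested) n k k' where "nested_at \<gamma> n k k'"
    using assms by (auto simp: perfectly_nested_circuit_def)
  then show ?thesis
  proof cases
    case simple
    then have "m = 0"
      using card_internal_vertices_simple_cycle assms(3) by metis
    then show ?thesis
      using nested.isomorphic[OF nested_simple_cycle[OF simple]] by simp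
  next
    case nested
    then have "n = m"
      using card_internal_vertices_nested_at assms(3) by metis
    then show ?thesis
      using nested.isomorphic[OF nested_nested_at[OF circ nested]] by simp
  qed
qed

end
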